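(* The class of $1$-perfectly orientable graphs is $(\mathrm{tw},\omega)$-bounded with a $(\mathrm{tw},\omega)$-binding function $f(k)=\max\{k,\,2R(k+1,3)-2\}-1$.
   Context: All graphs are finite, simple, undirected and have at least one vertex. A graph $G$ is $1$-perfectly orientable if it has an orientation $D$ such that for every vertex $v\in V(G)$, the out-neighborhood of $v$ in $D$ is a clique in $G$. $\mathrm{tw}(G)$ is the treewidth and $\omega(G)$ the clique number of $G$. A graph class $\mathcal{G}$ is $(\mathrm{tw},\omega)$-bounded if there is a function $f:\mathbb{N}\to\mathbb{N}$ such that for every $G\in\mathcal{G}$ and every induced subgraph $G'$ of $G$, $\mathrm{tw}(G')\le f(\omega(G'))$; such an $f$ is a $(\mathrm{tw},\omega)$-binding function for $\mathcal{G}$. The formula for $f(k)$ is understood for $k\ge 1$. $R(k,\ell)$ is the Ramsey number: the least positive integer such that every graph with at least $R(k,\ell)$ vertices contains a clique of size $k$ or an independent set of size $\ell$. *)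

theory Defs
  imports "HOL-Library.Ramsey"
begin

section \<open>Finite simple graphs\<close>

record 'a ugraph =
  verts :: "'a set"
  edges :: "'a set set"

text \<open>The null graph is excluded.  The notation \<open>[A]\<^bsup>2\<^esup>\<close> (the two-element subsets of \<open>A\<close>) and the
  predicates \<^const>\<open>clique\<close> and \<^const>\<open>indep\<close> come from \<^theory>\<open>HOL-Library.Ramsey\<close>.\<close>

definition simple_graph :: "'a ugraph \<Rightarrow> bool" where
  "simple_graph G \<longleftrightarrow> finite (verts G) \<and> verts G \<noteq> {} \<and> edges G \<subseteq> [verts G]\<^bsup>2\<^esup>"

definition induce :: "'a ugraph \<Rightarrow> 'a set \<Rightarrow> 'a ugraph" where
  "induce G S = \<lparr>verts = S, edges = {e \<in> edges G. e \<subseteq> S}\<rparr>"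

definition induced_subgraph :: "'a ugraph \<Rightarrow> 'a ugraph \<Rightarrow> bool" where
  "induced_subgraph H G \<longleftrightarrow> (\<exists>S. S \<subseteq> verts G \<and> S \<noteq> {} \<and> H = induce G S)"

definition clique_number :: "'a ugraph \<Rightarrow> nat" where
  "clique_number G = Max (card ` {K. K \<subseteq> verts G \<and> clique K (edges G)})"


section \<open>1-perfectly orientable graphs\<close>

definition orientation :: "'a ugraph \<Rightarrow> 'a rel \<Rightarrow> bool" where
  "orientation G D \<longleftrightarrow> D \<union> D\<inverse> = {(u, v). {u, v} \<in> edges G} \<and> D \<inter> D\<inverse> = {}"

definition one_perfectly_orientable :: "'a ugraph \<Rightarrow> bool" where
  "one_perfectly_orientable G \<longleftrightarrow>
     (\<exists>D. orientation G D \<and> (\<forall>v \<in> verts G. clique (D `` {v}) (edges G)))"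


section \<open>Trees and treewidth\<close>

definition walk :: "'a ugraph \<Rightarrow> 'a list \<Rightarrow> bool" where
  "walk G p \<longleftrightarrow> p \<noteq> [] \<and> set p \<subseteq> verts G \<and> successively (\<lambda>u v. {u, v} \<in> edges G) p"

definition connected_graph :: "'a ugraph \<Rightarrow> bool" where
  "connected_graph G \<longleftrightarrow> verts G \<noteq> {} \<and>
     (\<forall>u \<in> verts G. \<forall>v \<in> verts G. \<exists>p. walk G p \<and> hd p = u \<and> last p = v)"

definition cycle :: "'a ugraph \<Rightarrow> 'a list \<Rightarrow> bool" where
  "cycle G p \<longleftrightarrow> walk G p \<and> distinct p \<and> 3 \<le> length p \<and> {last p, hd p} \<in> edges G"

definition tree :: "'a ugraph \<Rightarrow> bool" where
  "tree T \<longleftrightarrow> simple_graph T \<and> connected_graph T \<and> (\<nexists>p. cycle T p)"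

definition tree_decomposition :: "'a ugraph \<Rightarrow> 'b ugraph \<Rightarrow> ('b \<Rightarrow> 'a set) \<Rightarrow> bool" where
  "tree_decomposition G T X \<longleftrightarrow> tree T \<and>
     (\<forall>t \<in> verts T. X t \<subseteq> verts G) \<and>
     (\<forall>v \<in> verts G. \<exists>t \<in> verts T. v \<in> X t) \<and>
     (\<forall>e \<in> edges G. \<exists>t \<in> verts T. e \<subseteq> X t) \<and>
     (\<forall>v \<in> verts G. connected_graph (induce T {t \<in> verts T. v \<in> X t}))"

text \<open>The subtraction does not truncate: graphs have a vertex, so some bag is nonempty.\<close>

definition decomposition_width :: "'b ugraph \<Rightarrow> ('b \<Rightarrow> 'a set) \<Rightarrow> nat" where
  "decomposition_width T X = Max ((\<lambda>t. card (X t)) ` verts T) - 1"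

text \<open>A definition cannot quantify over the type of tree nodes; natural numbers suffice, since trees
  are finite.\<close>

definition treewidth :: "'a ugraph \<Rightarrow> nat" where
  "treewidth G = (LEAST w. \<exists>(T :: nat ugraph) X.
     tree_decomposition G T X \<and> decomposition_width T X = w)"


section \<open>Boundedness of treewidth in terms of the clique number\<close>

definition tw_omega_binding :: "'a ugraph set \<Rightarrow> (nat \<Rightarrow> nat) \<Rightarrow> bool" where
  "tw_omega_binding \<G> f \<longleftrightarrow>
     (\<forall>G \<in> \<G>. \<forall>H. induced_subgraph H G \<longrightarrow> treewidth H \<le> f (clique_number H))"

definition tw_omega_bounded :: "'a ugraph set \<Rightarrow> bool" where
  "tw_omega_bounded \<G> \<longleftrightarrow> (\<exists>f. tw_omega_binding \<G> f)"


section \<open>Ramsey numbers\<close>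

text \<open>As graphs are finite, those with vertices in the natural numbers represent all of them.\<close>

definition ramsey_number :: "nat \<Rightarrow> nat \<Rightarrow> nat" where
  "ramsey_number k l = (LEAST r. 0 < r \<and>
     (\<forall>G :: nat ugraph. simple_graph G \<and> r \<le> card (verts G) \<longrightarrow>
        (\<exists>S \<subseteq> verts G. card S = k \<and> clique S (edges G) \<or> card S = l \<and> indep S (edges G))))"

end

theory Submission
  imports Defs
begin

text \<open>The proof has two halves, which meet in bags \<open>B\<close> that behave like potential maximal cliques: there
  are pairwise disjoint connected sets \<open>C\<close> outside \<open>B\<close>, with no edges between them, such that any two
  nonadjacent vertices of \<open>B\<close> have a common such \<open>C\<close> in whose neighbourhood both lie, while no
  single \<open>C\<close> has all of \<open>B\<close> in its neighbourhood.

  Every graph has a tree decomposition into such bags.  As long as the torso of a bag (its graph, with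
  the neighbourhood of each attached \<open>C\<close> made complete) is not complete, it is split along a minimal
  separator \<open>T\<close> of the torso.  Each of the two parts keeps \<open>T\<close>, and the other part shrinks to a
  connected set attached to all of \<open>T\<close>, so \<open>T\<close> is a clique of both new torsos and the two
  decompositions can be glued along it (lemma \<open>running_intersection_of_atoms\<close>).

  In a 1-perfectly orientable graph such a bag \<open>B\<close> is small in terms of the clique number.  If two connected sets are disjoint and
  without edges between them, then among the vertices adjacent to both no three are pairwise
  nonadjacent: of two nonadjacent vertices outside a connected set that both have neighbours in it, at
  least one has an arc into it, so of the three vertices at least two have arcs into the first set and
  at least two into the second, and a vertex with arcs into both contradicts that its out-neighbourhood is a clique (lemma
  \<open>triple_free_between_connected_sets\<close>).  If \<open>B\<close> is not a clique, thin out the family of attached sets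
  until it is minimal among those that cover all nonadjacent pairs; then some pair \<open>x\<close>, \<open>y\<close> is covered
  by a single set \<open>C\<close> only.  The vertices of \<open>B\<close> in the neighbourhood of \<open>C\<close> are all adjacent to \<open>C\<close>
  and to the connected set formed by some \<open>w \<in> B\<close> outside that neighbourhood and the other sets attached
  to \<open>w\<close>; the remaining vertices of \<open>B\<close> are all adjacent to the connected sets grown in the same way
  around \<open>x\<close> and around \<open>y\<close>.  So \<open>B\<close> is a union of two sets without independent triple (lemma
  \<open>atom_cover\<close>), and if the clique number is \<open>k\<close>, each of them has fewer than \<open>R(k + 1, 3)\<close> vertices.\<close>

section \<open>Connected sets in a 1-perfectly oriented graph\<close>

definition connected_on :: "'a rel \<Rightarrow> 'a set \<Rightarrow> bool" where
  "connected_on R Y \<longleftrightarrow> (\<forall>u \<in> Y. \<forall>v \<in> Y. (u, v) \<in> (R \<inter> Y \<times> Y)\<^sup>*)"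

text \<open>If neither vertex had an arc into \<open>C\<close>, the in-neighbours of \<open>s\<close> in \<open>C\<close> would be closed under arcs
  inside \<open>C\<close>, because two out-neighbours of the same vertex are adjacent, and likewise for \<open>t\<close>.  By the
  same clique property the set of vertices of \<open>C\<close> from which an in-neighbour of \<open>s\<close> can be reached
  along arcs is closed under arcs in both directions, hence is all of \<open>C\<close>.  So an in-neighbour of \<open>t\<close>
  reaches an in-neighbour of \<open>s\<close>, which by closure is an in-neighbour of \<open>t\<close> as well; then \<open>s\<close> and \<open>t\<close>
  are adjacent.\<close>

lemma out_neighbour_in_connected_set:
  assumes out: "\<And>v x y. (v, x) \<in> D \<Longrightarrow> (v, y) \<in> D \<Longrightarrow> x \<noteq> y \<Longrightarrow> (x, y) \<in> D \<union> D\<inverse>"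
    and conn: "connected_on (D \<union> D\<inverse>) C"
    and s: "s \<in> (D \<union> D\<inverse>) `` C" "s \<notin> C"
    and t: "t \<in> (D \<union> D\<inverse>) `` C" "t \<notin> C"
    and st: "s \<noteq> t" "(s, t) \<notin> D \<union> D\<inverse>"
  shows "\<exists>c \<in> C. (s, c) \<in> D \<or> (t, c) \<in> D"
proof (rule ccontr)
  assume none: "\<not> ?thesis"
  define X where "X = {c \<in> C. (c, s) \<in> D}"
  define Y where "Y = {c \<in> C. (c, t) \<in> D}"
  define reach where "reach = (D \<inter> C \<times> C)\<^sup>*"
  \<comment> \<open>In the end \<open>Z = C\<close>: it is nonempty and closed under edges inside \<open>C\<close>.\<close>
  define Z where "Z = {z \<in> C. \<exists>x \<in> X. (z, x) \<in> reach}"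
  obtain x0 y0 where x0: "x0 \<in> X" and y0: "y0 \<in> Y"
    using s t none by (auto simp: X_def Y_def)
  have disj: "X \<inter> Y = {}"
    using out st by (auto simp: X_def Y_def)
  have X_closed: "d \<in> X" if "c \<in> X" "(c, d) \<in> D" "d \<in> C" for c d
    using that out[of c s d] none s(2) by (auto simp: X_def)
  have Y_closed: "d \<in> Y" if "c \<in> Y" "(c, d) \<in> D" "d \<in> C" for c d
    using that out[of c t d] none t(2) by (auto simp: Y_def)
  have pred: "d \<in> Z" if "z \<in> Z" "(d, z) \<in> D" "d \<in> C" for d z
    using that unfolding Z_def reach_def by (blast intro: converse_rtrancl_into_rtrancl)
  have succ: "\<forall>d \<in> C. (z, d) \<in> D \<longrightarrow> d \<in> Z" if "x \<in> X" "(z, x) \<in> reach" for z x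
    using that(2) unfolding reach_def
  proof (induction rule: converse_rtrancl_induct)
    case base
    show ?case
      using X_closed[OF that(1)] by (auto simp: Z_def reach_def X_def)
  next
    case (step z z')
    then have z': "z' \<in> Z"
      using that(1) by (auto simp: Z_def reach_def)
    show ?case
    proof (intro ballI impI)
      fix d assume d: "d \<in> C" "(z, d) \<in> D"
      show "d \<in> Z"
      proof (cases "d = z'")
        case False
        then have "(d, z') \<in> D \<union> D\<inverse>"
          using out d(2) step.hyps(1) by blast
        then show ?thesis
          using d(1) step.IH pred[OF z'] by auto
      qed (use z' in simp)
    qed
  qed
  have "(x0, y0) \<in> ((D \<union> D\<inverse>) \<inter> C \<times> C)\<^sup>*"
    using conn x0 y0 by (auto simp: connected_on_def X_def Y_def)
  then have "y0 \<in> Z"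
  proof (induction rule: rtrancl_induct)
    case base
    show ?case
      using x0 by (auto simp: Z_def reach_def X_def)
  next
    case (step c d)
    then consider "(c, d) \<in> D" "d \<in> C" | "(d, c) \<in> D" "d \<in> C" by auto
    then show ?case
    proof cases
      case 1
      obtain x where "x \<in> X" "(c, x) \<in> reach"
        using step.IH unfolding Z_def by blast
      then show ?thesis using succ 1 by blast
    next
      case 2
      then show ?thesis using pred step.IH by blast
    qed
  qed
  then obtain x where x: "x \<in> X" "(y0, x) \<in> reach"
    by (auto simp: Z_def)
  from x(2) have "x \<in> Y"
    unfolding reach_def
    by (induction rule: rtrancl_induct) (use y0 Y_closed in blast)+
  with x(1) disj show False by blast
qed

definition triple_free :: "'a rel \<Rightarrow> 'a set \<Rightarrow> bool" where
  "triple_free R Z \<longleftrightarrow> (\<forall>a \<in> Z. \<forall>b \<in> Z. \<forall>c \<in> Z.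
     a \<noteq> b \<longrightarrow> a \<noteq> c \<longrightarrow> b \<noteq> c \<longrightarrow> (a, b) \<in> R \<or> (a, c) \<in> R \<or> (b, c) \<in> R)"

text \<open>The form in which the absence of an induced minor \<open>K\<^sub>2\<^sub>,\<^sub>3\<close> is used: \<open>P\<close> and \<open>Q\<close> play the two
  vertices of degree three.\<close>

lemma triple_free_between_connected_sets:
  assumes out: "\<And>v x y. (v, x) \<in> D \<Longrightarrow> (v, y) \<in> D \<Longrightarrow> x \<noteq> y \<Longrightarrow> (x, y) \<in> D \<union> D\<inverse>"
    and conn: "connected_on (D \<union> D\<inverse>) P" "connected_on (D \<union> D\<inverse>) Q"
    and disj: "P \<inter> Q = {}"
    and anti: "(D \<union> D\<inverse>) `` P \<inter> Q = {}"
    and Z: "Z \<subseteq> (D \<union> D\<inverse>) `` P" "Z \<subseteq> (D \<union> D\<inverse>) `` Q" "Z \<inter> (P \<union> Q) = {}"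
  shows "triple_free (D \<union> D\<inverse>) Z"
proof (rule ccontr)
  assume "\<not> ?thesis"
  then obtain a b c where abc: "a \<in> Z" "b \<in> Z" "c \<in> Z" "a \<noteq> b" "a \<noteq> c" "b \<noteq> c"
    and indep: "(a, b) \<notin> D \<union> D\<inverse>" "(a, c) \<notin> D \<union> D\<inverse>" "(b, c) \<notin> D \<union> D\<inverse>"
    unfolding triple_free_def by auto
  have pair: "s \<in> D\<inverse> `` W \<or> t \<in> D\<inverse> `` W"
    if "W = P \<or> W = Q" "s \<in> Z" "t \<in> Z" "s \<noteq> t" "(s, t) \<notin> D \<union> D\<inverse>" for W s t
  proof -
    have "connected_on (D \<union> D\<inverse>) W"
      using that(1) conn by auto
    moreover have "s \<in> (D \<union> D\<inverse>) `` W" "s \<notin> W" "t \<in> (D \<union> D\<inverse>) `` W" "t \<notin> W"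
      using that(1-3) Z by auto
    ultimately have "\<exists>c \<in> W. (s, c) \<in> D \<or> (t, c) \<in> D"
      using that(4,5) by (intro out_neighbour_in_connected_set[OF out])
    then show ?thesis by auto
  qed
  have not_both: "z \<notin> D\<inverse> `` P \<or> z \<notin> D\<inverse> `` Q" for z
  proof (rule ccontr)
    assume "\<not> ?thesis"
    then obtain p q where "p \<in> P" "q \<in> Q" "(z, p) \<in> D" "(z, q) \<in> D" by auto
    moreover from this disj have "p \<noteq> q" by auto
    ultimately show False
      using out[of z p q] anti by auto
  qed
  note pairs = pair[OF _ abc(1,2,4) indep(1)] pair[OF _ abc(1,3,5) indep(2)]
    pair[OF _ abc(2,3,6) indep(3)]
  \<comment> \<open>Two of the three vertices have arcs into \<open>P\<close> and two into \<open>Q\<close>, so one of them has both.\<close>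
  show False
    using pairs[of P, OF disjI1[OF refl]] pairs[of Q, OF disjI2[OF refl]]
      not_both[of a] not_both[of b] not_both[of c]
    by argo
qed

section \<open>Ramsey numbers bound sets without large cliques\<close>

lemma ramsey_number_property:
  "0 < ramsey_number k l \<and> (\<forall>G :: nat ugraph. simple_graph G \<and> ramsey_number k l \<le> card (verts G) \<longrightarrow>
     (\<exists>S \<subseteq> verts G. card S = k \<and> clique S (edges G) \<or> card S = l \<and> indep S (edges G)))"
proof -
  have "\<exists>r \<ge> 1. \<forall>(V :: nat set) E. finite V \<and> card V \<ge> r \<longrightarrow>
       (\<exists>S \<subseteq> V. card S = k \<and> clique S E \<or> card S = l \<and> indep S E)"
    by (rule ramsey2)
  then obtain r where r: "r \<ge> 1"
    "\<forall>(V :: nat set) E. finite V \<and> card V \<ge> r \<longrightarrow>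
       (\<exists>S \<subseteq> V. card S = k \<and> clique S E \<or> card S = l \<and> indep S E)"
    by (elim exE conjE)
  show ?thesis
    unfolding ramsey_number_def
  proof (rule LeastI[of _ r], intro conjI allI impI)
    fix G :: "nat ugraph" assume "simple_graph G \<and> r \<le> card (verts G)"
    then show "\<exists>S \<subseteq> verts G. card S = k \<and> clique S (edges G) \<or> card S = l \<and> indep S (edges G)"
      using r(2) by (simp add: simple_graph_def)
  qed (use r(1) in simp)
qed

text \<open>Transfers the defining property, which speaks of graphs on natural numbers, to subsets of any vertex
  type.  The edge set may be arbitrary, since only its pairs inside \<open>Z\<close> matter.\<close>

lemma card_less_ramsey_number:
  assumes "finite Z"
    and cl: "\<And>S. S \<subseteq> Z \<Longrightarrow> clique S E \<Longrightarrow> card S \<noteq> k"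
    and ind: "\<And>S. S \<subseteq> Z \<Longrightarrow> indep S E \<Longrightarrow> card S \<noteq> l"
  shows "card Z < ramsey_number k l"
proof (rule ccontr)
  assume big: "\<not> ?thesis"
  obtain f :: "'a \<Rightarrow> nat" where f: "inj_on f Z"
    using finite_imp_inj_to_nat_seg[OF \<open>finite Z\<close>] by auto
  define g where "g = the_inv_into Z f"
  have g: "g (f z) = z" if "z \<in> Z" for z
    using the_inv_into_f_f[OF f that] by (simp add: g_def)
  define G where "G = \<lparr>verts = f ` Z, edges = {e \<in> [f ` Z]\<^bsup>2\<^esup>. g ` e \<in> E}\<rparr>"
  have "card (verts G) = card Z"
    using f by (simp add: G_def card_image)
  moreover from this big have "simple_graph G"
    using ramsey_number_property[of k l] \<open>finite Z\<close> by (auto simp: simple_graph_def G_def)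
  ultimately obtain S where S: "S \<subseteq> f ` Z"
    "card S = k \<and> clique S (edges G) \<or> card S = l \<and> indep S (edges G)"
    using ramsey_number_property[of k l] big by (auto simp: G_def)
  obtain S' where S': "S' \<subseteq> Z" "S = f ` S'"
    using S(1) by (auto simp: subset_image_iff)
  have card: "card S' = card S"
    using S' f by (metis card_image inj_on_subset)
  have edge: "{f u, f v} \<in> edges G \<longleftrightarrow> {u, v} \<in> E" if "u \<in> S'" "v \<in> S'" "u \<noteq> v" for u v
  proof -
    have "f u \<noteq> f v" "u \<in> Z" "v \<in> Z"
      using that S'(1) f by (auto dest: inj_onD)
    then show ?thesis
      by (auto simp: G_def nsets_def g)
  qed
  have inj: "f u \<noteq> f v" if "u \<in> S'" "v \<in> S'" "u \<noteq> v" for u v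
    using that S'(1) f by (auto dest: inj_onD)
  have "clique S (edges G) \<Longrightarrow> clique S' E" "indep S (edges G) \<Longrightarrow> indep S' E"
    using edge inj unfolding clique_def indep_def S'(2) by blast+
  then show False
    using S(2) card cl ind S'(1) by metis
qed

section \<open>From the running intersection property to treewidth\<close>

text \<open>A tree decomposition given by its bags in a search order of the tree from its root: the index \<open>j\<close>
  can serve as the parent of node \<open>i\<close>.  This form can be glued by appending lists.\<close>

definition running_intersection :: "'a set list \<Rightarrow> bool" where
  "running_intersection xs \<longleftrightarrow>
     (\<forall>i < length xs. 0 < i \<longrightarrow> (\<exists>j < i. xs ! i \<inter> \<Union> (set (take i xs)) \<subseteq> xs ! j))"

text \<open>Everything that \<open>ys\<close> shares with \<open>xs\<close> lies in the root \<open>hd ys\<close>, so the root can be hung below the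
  bag \<open>b\<close> and the parents of all other bags of \<open>ys\<close> can stay.\<close>

lemma running_intersection_append:
  assumes xs: "running_intersection xs" and ys: "running_intersection ys" "ys \<noteq> []"
    and sep: "\<Union> (set xs) \<inter> \<Union> (set ys) \<subseteq> T" "T \<subseteq> hd ys"
    and b: "b \<in> set xs" "T \<subseteq> b"
  shows "running_intersection (xs @ ys)"
  unfolding running_intersection_def
proof (intro allI impI)
  fix i assume i: "i < length (xs @ ys)" "0 < i"
  show "\<exists>j < i. (xs @ ys) ! i \<inter> \<Union> (set (take i (xs @ ys))) \<subseteq> (xs @ ys) ! j"
  proof (cases "i < length xs")
    case True
    then obtain j where "j < i" "xs ! i \<inter> \<Union> (set (take i xs)) \<subseteq> xs ! j"
      using xs i(2) unfolding running_intersection_def by blast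
    then show ?thesis
      using True by (intro exI[of _ j]) (simp add: nth_append)
  next
    case False
    define m where "m = i - length xs"
    have m: "i = length xs + m" "m < length ys"
      using False i(1) by (auto simp: m_def)
    have ith: "(xs @ ys) ! i = ys ! m"
      using m by (simp add: nth_append)
    have "ys ! m \<subseteq> \<Union> (set ys)"
      using m(2) by (metis Union_upper nth_mem)
    then have old: "ys ! m \<inter> \<Union> (set xs) \<subseteq> T"
      using sep(1) by blast
    show ?thesis
    proof (cases "m = 0")
      case True
      obtain j where "j < length xs" "xs ! j = b"
        using b(1) by (auto simp: in_set_conv_nth)
      then show ?thesis
        using True m old b(2) ith by (intro exI[of _ j]) (auto simp: nth_append)
    next
      case False
      then obtain j where j: "j < m" "ys ! m \<inter> \<Union> (set (take m ys)) \<subseteq> ys ! j"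
        using ys(1) m(2) unfolding running_intersection_def by blast
      have "hd ys \<in> set (take m ys)"
        using False ys(2) by (cases ys; cases m) auto
      then have "ys ! m \<inter> \<Union> (set (take i (xs @ ys))) \<subseteq> ys ! j"
        using j(2) old sep(2) m(1) by auto
      then show ?thesis
        using j(1) m(1) ith by (intro exI[of _ "length xs + j"]) (simp add: nth_append)
    qed
  qed
qed

lemma walk_of_rtrancl:
  assumes "(u, v) \<in> {(a, b). a \<in> verts G \<and> b \<in> verts G \<and> {a, b} \<in> edges G}\<^sup>*" "u \<in> verts G"
  shows "\<exists>p. walk G p \<and> hd p = u \<and> last p = v"
  using assms(1)
proof (induction rule: rtrancl_induct)
  case base
  show ?case
    by (rule exI[of _ "[u]"]) (simp add: walk_def assms(2))
next
  case (step v w)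
  then obtain p where p: "walk G p" "hd p = u" "last p = v" by blast
  have "walk G (p @ [w])"
    using p step.hyps(2) by (auto simp: walk_def successively_append_iff)
  then show ?case
    using p by (intro exI[of _ "p @ [w]"]) (auto simp: walk_def)
qed

text \<open>The graph in which every positive \<open>i < n\<close> is joined to its parent \<open>p i\<close>; a tree with root \<open>0\<close> if
  parents are smaller than their children.\<close>

definition parent_graph :: "nat \<Rightarrow> (nat \<Rightarrow> nat) \<Rightarrow> nat ugraph" where
  "parent_graph n p = \<lparr>verts = {..<n}, edges = {{i, p i} |i. 0 < i \<and> i < n}\<rparr>"

lemma parent_graph_edge:
  assumes "{a, b} \<in> edges (parent_graph n p)" "\<And>i. 0 < i \<Longrightarrow> i < n \<Longrightarrow> p i < i" "b < a"
  shows "b = p a"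
proof -
  obtain i where "{a, b} = {i, p i}" "0 < i" "i < n"
    using assms(1) by (auto simp: parent_graph_def)
  with assms(2)[of i] \<open>b < a\<close> show ?thesis
    by (auto simp: doubleton_eq_iff)
qed

text \<open>Climbing to the parent stays in \<open>I\<close> until \<open>r\<close> is reached.  Used for the whole tree and for the
  nodes whose bag contains a given vertex.\<close>

lemma connected_parent_graph:
  assumes I: "I \<subseteq> {..<n}" "r \<in> I"
    and parent: "\<And>i. i \<in> I \<Longrightarrow> i \<noteq> r \<Longrightarrow> 0 < i \<and> p i \<in> I \<and> p i < i"
  shows "connected_graph (induce (parent_graph n p) I)"
proof -
  let ?G = "induce (parent_graph n p) I"
  let ?R = "{(a, b). a \<in> verts ?G \<and> b \<in> verts ?G \<and> {a, b} \<in> edges ?G}"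
  have sym: "sym ?R"
    by (auto simp: sym_def insert_commute)
  have to_root: "(i, r) \<in> ?R\<^sup>*" if "i \<in> I" for i
    using that
  proof (induction i rule: less_induct)
    case (less i)
    show ?case
    proof (cases "i = r")
      case False
      then have p: "0 < i" "p i \<in> I" "p i < i"
        using parent less.prems by auto
      then have "(i, p i) \<in> ?R"
        using less.prems I(1) by (auto simp: induce_def parent_graph_def)
      then show ?thesis
        using less.IH[OF p(3,2)] by (rule converse_rtrancl_into_rtrancl)
    qed simp
  qed
  have "(u, v) \<in> ?R\<^sup>*" if "u \<in> I" "v \<in> I" for u v
    using to_root[OF that(1)] to_root[OF that(2)] sym_rtrancl[OF sym]
    by (meson rtrancl_trans symD)
  then show ?thesis
    using walk_of_rtrancl[of _ _ ?G] I(2) unfolding connected_graph_def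
    by (auto simp: induce_def)
qed

text \<open>The largest vertex of a cycle would have two different smaller neighbours, but its only smaller
  neighbour is its parent.\<close>

lemma no_cycle_parent_graph:
  assumes parent: "\<And>i. 0 < i \<Longrightarrow> i < n \<Longrightarrow> p i < i"
  shows "\<not> cycle (parent_graph n p) c"
proof
  let ?G = "parent_graph n p"
  assume cyc: "cycle ?G c"
  define l where "l = length c"
  have l: "3 \<le> l" and dist: "distinct c" and c: "c \<noteq> []"
    using cyc by (auto simp: cycle_def l_def walk_def)
  have edge: "{c ! i, c ! (Suc i mod l)} \<in> edges ?G" if "i < l" for i
  proof (cases "Suc i < l")
    case True
    then show ?thesis
      using cyc successively_nth[of "\<lambda>u v. {u, v} \<in> edges ?G" c i]
      by (simp add: cycle_def walk_def l_def)
  next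
    case False
    then have "i = l - 1" using that by simp
    then show ?thesis
      using cyc c l by (simp add: cycle_def last_conv_nth hd_conv_nth l_def)
  qed
  obtain m where m: "m < l" "c ! m = Max (set c)"
    using Max_in[of "set c"] c by (auto simp: in_set_conv_nth l_def)
  define a where "a = Suc m mod l"
  define b where "b = (m + (l - 1)) mod l"
  have ab: "a < l" "b < l" "a \<noteq> m" "b \<noteq> m" "a \<noteq> b" "Suc b mod l = m"
    using l m(1) by (auto simp: a_def b_def mod_if)
  have less: "c ! i < c ! m" if "i < l" "i \<noteq> m" for i
    using that m dist by (metis List.finite_set Max_ge l_def le_neq_implies_less nth_eq_iff_index_eq nth_mem)
  have "{c ! m, c ! a} \<in> edges ?G" "{c ! m, c ! b} \<in> edges ?G"
    using edge[OF m(1)] edge[OF ab(2)] ab(6) by (simp_all add: a_def insert_commute)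
  then have "c ! a = p (c ! m)" "c ! b = p (c ! m)"
    using parent_graph_edge[OF _ parent] less[OF ab(1,3)] less[OF ab(2,4)] by blast+
  then show False
    using ab dist l_def by (metis nth_eq_iff_index_eq)
qed

lemma treewidth_le_of_running_intersection:
  assumes fin: "finite (verts G)"
    and xs: "xs \<noteq> []" "running_intersection xs" "\<Union> (set xs) = verts G"
    and edges: "\<And>e. e \<in> edges G \<Longrightarrow> \<exists>b \<in> set xs. e \<subseteq> b"
    and size: "\<And>b. b \<in> set xs \<Longrightarrow> card b \<le> N"
  shows "treewidth G \<le> N - 1"
proof -
  define n where "n = length xs"
  have n: "0 < n" using xs(1) by (simp add: n_def)
  have "\<forall>i. \<exists>j. 0 < i \<and> i < n \<longrightarrow> j < i \<and> xs ! i \<inter> \<Union> (set (take i xs)) \<subseteq> xs ! j"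
    using xs(2) unfolding running_intersection_def n_def by blast
  from choice[OF this] obtain p where
    "\<forall>i. 0 < i \<and> i < n \<longrightarrow> p i < i \<and> xs ! i \<inter> \<Union> (set (take i xs)) \<subseteq> xs ! (p i)" ..
  then have p: "\<And>i. 0 < i \<Longrightarrow> i < n \<Longrightarrow> p i < i"
    "\<And>i. 0 < i \<Longrightarrow> i < n \<Longrightarrow> xs ! i \<inter> \<Union> (set (take i xs)) \<subseteq> xs ! (p i)"
    by simp_all
  have p_n: "p i < n" if "0 < i" "i < n" for i
    using p(1) that order.strict_trans by blast
  let ?T = "parent_graph n p" and ?X = "\<lambda>i. xs ! i"
  have induce_all: "induce ?T {..<n} = ?T"
    using p_n by (auto simp: induce_def parent_graph_def)
  have "connected_graph (induce ?T {..<n})"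
    by (rule connected_parent_graph[of _ _ 0]) (use p(1) p_n n in auto)
  then have "connected_graph ?T"
    by (simp add: induce_all)
  moreover have "simple_graph ?T"
  proof -
    have "{i, p i} \<in> [{..<n}]\<^bsup>2\<^esup>" if "0 < i" "i < n" for i
      using p(1)[OF that] p_n[OF that] that(2) by (simp add: nsets_def)
    then show ?thesis
      using n by (auto simp: simple_graph_def parent_graph_def)
  qed
  ultimately have tree: "tree ?T"
    using no_cycle_parent_graph p(1) by (auto simp: tree_def)
  have bags: "set xs = ?X ` verts ?T"
    by (auto simp: in_set_conv_nth parent_graph_def n_def)
  have conn: "connected_graph (induce ?T {t \<in> verts ?T. v \<in> ?X t})" if "v \<in> verts G" for v
  proof -
    let ?I = "{t \<in> verts ?T. v \<in> ?X t}"
    \<comment> \<open>The first bag that contains \<open>v\<close> is the root of the subtree of \<open>v\<close>: in every later bag, \<open>v\<close> also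
      occurs earlier and so belongs to the parent bag.\<close>
    define r where "r = Min ?I"
    have "finite ?I" by (simp add: parent_graph_def)
    moreover have "?I \<noteq> {}"
      using that xs(3) by (auto simp: bags)
    ultimately have r: "r \<in> ?I" and r_le: "\<And>i. i \<in> ?I \<Longrightarrow> r \<le> i"
      unfolding r_def by (auto simp del: mem_Collect_eq)
    show ?thesis
    proof (rule connected_parent_graph[OF _ r])
      fix i assume i: "i \<in> ?I" "i \<noteq> r"
      then have "r < i" "i < n"
        using r_le[OF i(1)] by (auto simp: parent_graph_def)
      then have "?X r \<in> set (take i xs)"
        by (auto simp: in_set_conv_nth n_def intro!: exI[of _ r])
      then have "v \<in> xs ! (p i)"
        using p(2)[of i] \<open>r < i\<close> \<open>i < n\<close> i(1) r by auto
      then show "0 < i \<and> p i \<in> ?I \<and> p i < i"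
        using p(1)[of i] \<open>r < i\<close> \<open>i < n\<close> by (auto simp: parent_graph_def)
    qed (auto simp: parent_graph_def)
  qed
  have td: "tree_decomposition G ?T ?X"
    unfolding tree_decomposition_def
  proof (intro conjI ballI)
    show "?X t \<subseteq> verts G" if "t \<in> verts ?T" for t
      using that xs(3) by (auto simp: bags)
    show "\<exists>t \<in> verts ?T. v \<in> ?X t" if "v \<in> verts G" for v
      using that xs(3) by (auto simp: bags)
    show "\<exists>t \<in> verts ?T. e \<subseteq> ?X t" if "e \<in> edges G" for e
      using edges[OF that] by (simp add: bags)
  qed (use tree conn in auto)
  have "Max ((\<lambda>t. card (?X t)) ` verts ?T) \<le> N"
    using n size bags by (subst Max_le_iff) (auto simp: parent_graph_def)
  then have "decomposition_width ?T ?X \<le> N - 1"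
    by (simp add: decomposition_width_def)
  moreover have "treewidth G \<le> decomposition_width ?T ?X"
    unfolding treewidth_def by (rule Least_le) (use td in blast)
  ultimately show ?thesis by simp
qed

section \<open>Torsos and attached connected sets\<close>

text \<open>Adjacency after every \<open>C \<in> F\<close> has been replaced by a clique on its neighbourhood \<open>R `` C\<close>.\<close>

definition torso :: "'a rel \<Rightarrow> 'a set set \<Rightarrow> 'a rel" where
  "torso R F = {(u, v). u \<noteq> v \<and> ((u, v) \<in> R \<or> (\<exists>C \<in> F. u \<in> R `` C \<and> v \<in> R `` C))}"

text \<open>Two vertices adjacent in the torso may be joined only through a member of \<open>F\<close>; adding these members
  turns a set that is connected in the torso into one that is connected in the graph itself, and whose
  neighbours are the torso neighbours of the original set.\<close>

definition absorb :: "'a rel \<Rightarrow> 'a set set \<Rightarrow> 'a set \<Rightarrow> 'a set" where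
  "absorb R F Y = Y \<union> \<Union> {C \<in> F. R `` C \<inter> Y \<noteq> {}}"

definition complete_on :: "'a rel \<Rightarrow> 'a set \<Rightarrow> bool" where
  "complete_on R K \<longleftrightarrow> (\<forall>u \<in> K. \<forall>v \<in> K. u \<noteq> v \<longrightarrow> (u, v) \<in> R)"

text \<open>The last clause makes \<open>R `` C \<inter> B\<close> behave like a minimal separator: every vertex of it has neighbours
  both in \<open>C\<close> and in a connected set \<open>Y\<close> on the other side, a full set of \<open>C\<close>.  It
  guarantees a vertex of \<open>B\<close> outside the neighbourhood of \<open>C\<close>, in a form that is inherited when a bag is split.\<close>

definition attached :: "'a rel \<Rightarrow> 'a set \<Rightarrow> 'a set set \<Rightarrow> bool" where
  "attached R B F \<longleftrightarrow> finite F \<and>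
     (\<forall>C \<in> F. connected_on R C \<and> C \<inter> B = {}) \<and>
     (\<forall>C \<in> F. \<forall>C' \<in> F. C \<noteq> C' \<longrightarrow> C \<inter> C' = {} \<and> R `` C \<inter> C' = {}) \<and>
     (\<forall>C \<in> F. \<exists>Y \<subseteq> B - R `` C. Y \<noteq> {} \<and> connected_on (torso R F) Y \<and>
        R `` C \<inter> B \<subseteq> torso R F `` Y)"

lemma sym_torso: "sym R \<Longrightarrow> sym (torso R F)"
  by (auto simp: sym_def torso_def)

lemma Image_absorb:
  assumes "v \<notin> Y"
  shows "v \<in> R `` absorb R F Y \<longleftrightarrow> v \<in> torso R F `` Y"
proof
  assume "v \<in> R `` absorb R F Y"
  then consider (direct) y where "y \<in> Y" "(y, v) \<in> R"
    | (via) C y where "C \<in> F" "y \<in> Y" "y \<in> R `` C" "v \<in> R `` C"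
    unfolding absorb_def by auto
  then show "v \<in> torso R F `` Y"
  proof cases
    case direct
    moreover from this assms have "y \<noteq> v" by auto
    ultimately show ?thesis by (auto simp: torso_def)
  next
    case via
    moreover from this assms have "y \<noteq> v" by auto
    ultimately have "(y, v) \<in> torso R F"
      unfolding torso_def by blast
    with via(2) show ?thesis by auto
  qed
next
  assume "v \<in> torso R F `` Y"
  then obtain y where "y \<in> Y" "(y, v) \<in> R \<or> (\<exists>C \<in> F. y \<in> R `` C \<and> v \<in> R `` C)"
    by (auto simp: torso_def)
  then show "v \<in> R `` absorb R F Y"
    unfolding absorb_def by auto
qed

lemma rtrancl_restrict_mono:
  "(u, v) \<in> (R \<inter> Y \<times> Y)\<^sup>* \<Longrightarrow> R \<inter> Y \<times> Y \<subseteq> R' \<Longrightarrow> Y \<subseteq> Y' \<Longrightarrow> (u, v) \<in> (R' \<inter> Y' \<times> Y')\<^sup>*"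
  by (rule subsetD[OF rtrancl_mono]) auto

lemma sym_rtrancl_restrict: "sym R \<Longrightarrow> (u, v) \<in> (R \<inter> Y \<times> Y)\<^sup>* \<Longrightarrow> (v, u) \<in> (R \<inter> Y \<times> Y)\<^sup>*"
  by (rule symD[OF sym_rtrancl]) (auto simp: sym_def)

lemma connected_on_mono: "connected_on R Y \<Longrightarrow> R \<inter> Y \<times> Y \<subseteq> R' \<Longrightarrow> connected_on R' Y"
  unfolding connected_on_def by (intro ballI, rule rtrancl_restrict_mono[OF _ _ order.refl]) auto

lemma connected_on_hub:
  assumes "sym R" "r \<in> Y" "\<And>y. y \<in> Y \<Longrightarrow> (y, r) \<in> (R \<inter> Y \<times> Y)\<^sup>*"
  shows "connected_on R Y"
  unfolding connected_on_def
proof (intro ballI)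
  fix u v assume "u \<in> Y" "v \<in> Y"
  then show "(u, v) \<in> (R \<inter> Y \<times> Y)\<^sup>*"
    using rtrancl_trans[OF assms(3) sym_rtrancl_restrict[OF assms(1,3)]] by simp
qed

lemma connected_on_singleton: "connected_on R {x}"
  by (simp add: connected_on_def)

lemma connected_absorb:
  assumes R: "sym R" and Y: "connected_on (torso R F) Y"
    and F: "\<And>C. C \<in> F \<Longrightarrow> connected_on R C"
  shows "connected_on R (absorb R F Y)"
proof (cases "Y = {}")
  case True
  then show ?thesis by (simp add: absorb_def connected_on_def)
next
  case False
  then obtain r where r: "r \<in> Y" by auto
  define W where "W = absorb R F Y"
  let ?S = "(R \<inter> W \<times> W)\<^sup>*"
  have Y_W: "Y \<subseteq> W"
    by (auto simp: W_def absorb_def)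
  have C_W: "C \<subseteq> W" if "C \<in> F" "y \<in> Y" "y \<in> R `` C" for C y
    using that by (auto simp: W_def absorb_def)
  have step: "(c, y) \<in> ?S" if Cy: "C \<in> F" "y \<in> Y" "y \<in> R `` C" "c \<in> C" for C y c
  proof -
    obtain c' where c': "c' \<in> C" "(c', y) \<in> R"
      using Cy(3) by auto
    have "C \<subseteq> W" by (rule C_W[OF Cy(1-3)])
    have "(c, c') \<in> (R \<inter> C \<times> C)\<^sup>*"
      using F[OF Cy(1)] Cy(4) c'(1) by (simp add: connected_on_def)
    then have "(c, c') \<in> ?S"
      by (rule rtrancl_restrict_mono) (use \<open>C \<subseteq> W\<close> in auto)
    moreover have "(c', y) \<in> R \<inter> W \<times> W"
      using c' Cy(2) \<open>C \<subseteq> W\<close> Y_W by auto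
    ultimately show ?thesis by (rule rtrancl_into_rtrancl)
  qed
  have edge: "(y, y') \<in> ?S" if yy: "(y, y') \<in> torso R F" "y \<in> Y" "y' \<in> Y" for y y'
  proof -
    consider "(y, y') \<in> R" | C where "C \<in> F" "y \<in> R `` C" "y' \<in> R `` C"
      using yy(1) by (auto simp: torso_def)
    then show ?thesis
    proof cases
      case 1
      then show ?thesis using yy(2,3) Y_W by auto
    next
      case 2
      then obtain c where "c \<in> C" by auto
      then have "(c, y) \<in> ?S" "(c, y') \<in> ?S"
        using step 2 yy(2,3) by auto
      then show ?thesis
        by (rule rtrancl_trans[OF sym_rtrancl_restrict[OF R]])
    qed
  qed
  have to_r: "(y, r) \<in> ?S" if "y \<in> Y" for y
  proof -
    have "(y, r) \<in> (torso R F \<inter> Y \<times> Y)\<^sup>*"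
      using Y that r by (simp add: connected_on_def)
    then show ?thesis
    proof (induction rule: converse_rtrancl_induct)
      case (step y y')
      then have "(y, y') \<in> ?S" using edge[of y y'] by simp
      then show ?case using step.IH by (rule rtrancl_trans)
    qed simp
  qed
  have "(w, r) \<in> ?S" if w: "w \<in> W" for w
  proof (cases "w \<in> Y")
    case True
    then show ?thesis by (rule to_r)
  next
    case False
    then obtain C y where Cy: "C \<in> F" "y \<in> Y" "y \<in> R `` C" "w \<in> C"
      using w by (auto simp: W_def absorb_def)
    show ?thesis
      by (rule rtrancl_trans[OF step[OF Cy] to_r[OF Cy(2)]])
  qed
  then show ?thesis
    using connected_on_hub[OF R, of r W] r Y_W by (auto simp: W_def)
qed

lemma Image_absorb_separator:
  assumes R: "sym R"
    and disj: "P \<inter> T = {}" "P \<inter> Q = {}" "T \<inter> Q = {}"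
    and sep: "torso R F `` P \<inter> Q = {}"
    and Y: "Y \<subseteq> Q" "T \<subseteq> torso R F `` Y"
  shows "R `` absorb R F Y \<inter> (P \<union> T) = T"
proof -
  have "v \<in> R `` absorb R F Y \<longleftrightarrow> v \<in> T" if "v \<in> P \<union> T" for v
  proof -
    have "v \<notin> Y" using that Y(1) disj by auto
    moreover have "v \<notin> torso R F `` Y" if "v \<in> P"
    proof
      assume "v \<in> torso R F `` Y"
      then obtain y where "y \<in> Y" "(y, v) \<in> torso R F" by auto
      then have "y \<in> torso R F `` P"
        using symD[OF sym_torso[OF R]] \<open>v \<in> P\<close> by auto
      then show False using sep Y(1) \<open>y \<in> Y\<close> by auto
    qed
    ultimately show ?thesis
      using Image_absorb[of v Y R F] that Y(2) by auto
  qed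
  then show ?thesis by auto
qed

text \<open>A separation of the torso of \<open>P \<union> T \<union> Q\<close> along \<open>T\<close> with full connected sets \<open>YP\<close> and \<open>YQ\<close> on both
  sides.  The assumptions are symmetric in \<open>P\<close> and \<open>Q\<close>; what is proved about the part \<open>P \<union> T\<close> applies
  to \<open>Q \<union> T\<close> by exchanging them.\<close>

locale separated =
  fixes R :: "'a rel" and P T Q YP YQ :: "'a set" and F :: "'a set set"
  assumes R: "sym R"
    and att: "attached R (P \<union> T \<union> Q) F"
    and disj: "P \<inter> T = {}" "P \<inter> Q = {}" "T \<inter> Q = {}"
    and sep: "torso R F `` P \<inter> Q = {}"
    and YP: "YP \<subseteq> P" "YP \<noteq> {}" "connected_on (torso R F) YP" "T \<subseteq> torso R F `` YP"
    and YQ: "YQ \<subseteq> Q" "YQ \<noteq> {}" "connected_on (torso R F) YQ" "T \<subseteq> torso R F `` YQ"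
begin

text \<open>The family attached to \<open>P \<union> T\<close>.  The other side is represented by the single set grown from \<open>YQ\<close>,
  and members of \<open>F\<close> with neighbours in \<open>Q\<close> are dropped: some of them are absorbed into that set, and
  any pair inside \<open>P \<union> T\<close> that such a member covers lies in \<open>T\<close>, where the new set covers it.\<close>

definition side :: "'a set set" where
  "side = insert (absorb R F YQ) {C \<in> F. R `` C \<inter> (P \<union> T \<union> Q) \<subseteq> P \<union> T}"

lemma sym_tor: "(u, v) \<in> torso R F \<Longrightarrow> (v, u) \<in> torso R F"
  using symD[OF sym_torso[OF R]] .

lemma no_edge: "(u, v) \<in> torso R F \<Longrightarrow> u \<in> P \<Longrightarrow> v \<in> Q \<Longrightarrow> False"
  using sep by auto

lemma boundary: "R `` absorb R F YQ \<inter> (P \<union> T) = T"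
  by (rule Image_absorb_separator[OF R disj sep YQ(1,4)])

lemma complete_boundary: "complete_on (torso R side) T"
  using boundary unfolding complete_on_def torso_def side_def by auto

lemma torso_side:
  assumes uv: "(u, v) \<in> torso R F" "u \<in> P \<union> T" "v \<in> P \<union> T"
  shows "(u, v) \<in> torso R side"
proof (cases "u \<in> T \<and> v \<in> T")
  case True
  then show ?thesis
    using complete_boundary uv(1) by (auto simp: complete_on_def torso_def)
next
  case False
  consider "(u, v) \<in> R" "u \<noteq> v" | C where "C \<in> F" "u \<in> R `` C" "v \<in> R `` C" "u \<noteq> v"
    using uv(1) by (auto simp: torso_def)
  then show ?thesis
  proof cases
    case 1
    then show ?thesis by (simp add: torso_def)
  next
    case 2
    have "R `` C \<inter> Q = {}"
    proof (rule ccontr)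
      assume "\<not> ?thesis"
      then obtain q where q: "q \<in> R `` C" "q \<in> Q" by blast
      then have "q \<noteq> u" "q \<noteq> v" using uv disj by auto
      with q 2 have "(u, q) \<in> torso R F" "(v, q) \<in> torso R F"
        unfolding torso_def by blast+
      then show False using no_edge q(2) False uv(2,3) by blast
    qed
    then have "C \<in> side"
      using 2(1) unfolding side_def by blast
    with 2 show ?thesis unfolding torso_def by blast
  qed
qed

text \<open>A walk that leaves \<open>P \<union> T\<close> does so through \<open>T\<close> and comes back through \<open>T\<close>, which is complete in the new
  torso, so the excursion can be replaced by one edge.\<close>

lemma connected_side:
  assumes E: "connected_on (torso R F) E" "E \<subseteq> P \<union> T \<union> Q"
  shows "connected_on (torso R side) (E \<inter> (P \<union> T))"
  unfolding connected_on_def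
proof (intro ballI)
  let ?E = "E \<inter> (P \<union> T)"
  let ?S = "(torso R side \<inter> ?E \<times> ?E)\<^sup>*"
  fix u v assume uv: "u \<in> ?E" "v \<in> ?E"
  have extend: "(u, z') \<in> ?S" if "(u, z) \<in> ?S" "(z, z') \<in> torso R side" "z \<in> ?E" "z' \<in> ?E" for z z'
    using that by (auto intro: rtrancl_into_rtrancl)
  have "(u, v) \<in> (torso R F \<inter> E \<times> E)\<^sup>*"
    using E(1) uv by (auto simp: connected_on_def)
  then have "(v \<in> P \<union> T \<longrightarrow> (u, v) \<in> ?S) \<and> (v \<in> Q \<longrightarrow> (\<forall>t \<in> T \<inter> E. (u, t) \<in> ?S))"
  proof (induction rule: rtrancl_induct)
    case base
    then show ?case using uv(1) disj by auto
  next
    case (step z z')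
    then have z: "(z, z') \<in> torso R F" "z \<in> E" "z' \<in> E" by auto
    consider "z \<in> P \<union> T" | "z \<in> Q" using z(2) E(2) by auto
    then show ?case
    proof cases
      case 1
      then have uz: "(u, z) \<in> ?S" using step.IH by simp
      consider "z' \<in> P \<union> T" | "z' \<in> Q" using z(3) E(2) by auto
      then show ?thesis
      proof cases
        assume z': "z' \<in> P \<union> T"
        have "(u, z') \<in> ?S"
          using \<open>z \<in> P \<union> T\<close> z z' torso_side[OF z(1)] by (intro extend[OF uz]) auto
        then show ?thesis using z' disj by auto
      next
        assume z': "z' \<in> Q"
        then have "z \<in> T" using no_edge[OF z(1)] 1 by auto
        have "(u, t) \<in> ?S" if t: "t \<in> T \<inter> E" for t
        proof (cases "t = z")
          case False
          then have "(z, t) \<in> torso R side"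
            using complete_boundary \<open>z \<in> T\<close> t by (auto simp: complete_on_def)
          then show ?thesis
            using t z(2) \<open>z \<in> T\<close> by (intro extend[OF uz]) auto
        qed (use uz in simp)
        then show ?thesis using z' disj by auto
      qed
    next
      case 2
      then have IH: "\<forall>t \<in> T \<inter> E. (u, t) \<in> ?S" using step.IH by simp
      have "z' \<notin> P" using no_edge[OF sym_tor[OF z(1)]] 2 by auto
      then show ?thesis using IH z(3) disj by auto
    qed
  qed
  then show "(u, v) \<in> ?S" using uv by blast
qed

lemma connected_one_side:
  assumes E: "connected_on (torso R F) E" "E \<subseteq> P \<union> Q" and u: "u \<in> E" "u \<in> Q"
  shows "E \<subseteq> Q"
proof
  fix v assume "v \<in> E"
  then have "(u, v) \<in> (torso R F \<inter> E \<times> E)\<^sup>*"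
    using E(1) u(1) by (simp add: connected_on_def)
  then show "v \<in> Q"
  proof (induction rule: rtrancl_induct)
    case (step z z')
    then have "z' \<notin> P" using no_edge[OF sym_tor, of z z'] by auto
    then show ?case using step.hyps(2) E(2) by auto
  qed (use u in simp)
qed

text \<open>The full set \<open>E\<close> of \<open>C\<close> survives the split, in one of three ways.  If \<open>E\<close> meets \<open>T\<close>, then its part in
  \<open>P \<union> T\<close> is still full, as a vertex of \<open>T\<close> that has lost its neighbour in \<open>E\<close> is now adjacent to \<open>E \<inter> T\<close>.
  If \<open>E\<close> lies in \<open>P\<close>, nothing changes.  If \<open>E\<close> lies in \<open>Q\<close>, then the neighbours of \<open>C\<close> all lie in \<open>T\<close>,
  and \<open>YP\<close> together with the rest of \<open>T\<close> takes the place of \<open>E\<close>.\<close>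

lemma full_set_side:
  assumes C: "C \<in> F" "R `` C \<inter> (P \<union> T \<union> Q) \<subseteq> P \<union> T"
  shows "\<exists>Y \<subseteq> P \<union> T - R `` C. Y \<noteq> {} \<and> connected_on (torso R side) Y \<and>
    R `` C \<inter> (P \<union> T) \<subseteq> torso R side `` Y"
proof -
  have "\<forall>C \<in> F. \<exists>Y \<subseteq> P \<union> T \<union> Q - R `` C. Y \<noteq> {} \<and> connected_on (torso R F) Y \<and>
      R `` C \<inter> (P \<union> T \<union> Q) \<subseteq> torso R F `` Y"
    using att unfolding attached_def by (elim conjE)
  from bspec[OF this C(1)] obtain E where E: "E \<subseteq> P \<union> T \<union> Q - R `` C" "E \<noteq> {}"
    "connected_on (torso R F) E" "R `` C \<inter> (P \<union> T \<union> Q) \<subseteq> torso R F `` E"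
    by (elim exE conjE)
  consider (meets) t where "t \<in> E" "t \<in> T" | (far) "E \<inter> T = {}" "E \<subseteq> Q" | (near) "E \<subseteq> P"
  proof (cases "E \<inter> T = {}")
    case True
    then have E_PQ: "E \<subseteq> P \<union> Q" using E(1) by auto
    show ?thesis
    proof (cases "E \<subseteq> P")
      case False
      then obtain u where "u \<in> E" "u \<in> Q" using E_PQ by auto
      then show ?thesis using connected_one_side[OF E(3) E_PQ] True far by auto
    qed (use near in auto)
  qed (use meets in auto)
  then show ?thesis
  proof cases
    case meets
    have "z \<in> torso R side `` (E \<inter> (P \<union> T))" if z: "z \<in> R `` C" "z \<in> P \<union> T" for z
    proof -
      obtain e where e: "e \<in> E" "(e, z) \<in> torso R F"
        using E(4) z by auto
      show ?thesis
      proof (cases "e \<in> Q")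
        case True
        then have "z \<in> T" using no_edge[OF sym_tor[OF e(2)]] z(2) by auto
        moreover have "t \<noteq> z" using meets(1) E(1) z(1) by auto
        ultimately have "(t, z) \<in> torso R side"
          using complete_boundary meets(2) by (auto simp: complete_on_def)
        then show ?thesis using meets by auto
      next
        case False
        then have "e \<in> P \<union> T" using e(1) E(1) by auto
        then show ?thesis using torso_side[OF e(2)] z(2) e(1) by auto
      qed
    qed
    moreover have "connected_on (torso R side) (E \<inter> (P \<union> T))"
      by (rule connected_side[OF E(3)]) (use E(1) in auto)
    ultimately show ?thesis
      using E(1) meets by (intro exI[of _ "E \<inter> (P \<union> T)"]) auto
  next
    case near
    have "z \<in> torso R side `` E" if z: "z \<in> R `` C" "z \<in> P \<union> T" for z
    proof -
      obtain e where e: "e \<in> E" "(e, z) \<in> torso R F"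
        using E(4) z by auto
      then show ?thesis using torso_side[OF e(2)] near z(2) by auto
    qed
    moreover have "connected_on (torso R side) E"
      using E(3) by (rule connected_on_mono) (use torso_side near in auto)
    ultimately show ?thesis
      using E(1,2) near by (intro exI[of _ E]) auto
  next
    case far
    have C_T: "R `` C \<inter> (P \<union> T) \<subseteq> T"
    proof
      fix z assume z: "z \<in> R `` C \<inter> (P \<union> T)"
      then obtain e where e: "e \<in> E" "(e, z) \<in> torso R F"
        using E(4) by auto
      then show "z \<in> T"
        using no_edge[OF sym_tor[OF e(2)]] far(2) z by auto
    qed
    have near_YP: "\<exists>y \<in> YP. (y, t) \<in> torso R side" if t: "t \<in> T" for t
    proof -
      obtain y where y: "y \<in> YP" "(y, t) \<in> torso R F"
        using YP(4) t by auto
      then show ?thesis using torso_side[OF y(2)] t YP(1) by auto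
    qed
    define Y where "Y = YP \<union> (T - R `` C)"
    obtain r where r: "r \<in> YP" using YP(2) by auto
    have YP_conn: "(y, r) \<in> (torso R side \<inter> Y \<times> Y)\<^sup>*" if "y \<in> YP" for y
    proof -
      have "(y, r) \<in> (torso R F \<inter> YP \<times> YP)\<^sup>*"
        using YP(3) that r by (simp add: connected_on_def)
      then show ?thesis
        by (rule rtrancl_restrict_mono) (use torso_side YP(1) in \<open>auto simp: Y_def\<close>)
    qed
    have "(y, r) \<in> (torso R side \<inter> Y \<times> Y)\<^sup>*" if "y \<in> Y" for y
    proof (cases "y \<in> YP")
      case False
      then have "y \<in> T" using that by (simp add: Y_def)
      from near_YP[OF this] obtain y' where y': "y' \<in> YP" "(y', y) \<in> torso R side" ..
      then have "(y, y') \<in> torso R side \<inter> Y \<times> Y"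
        using that symD[OF sym_torso[OF R]] by (auto simp: Y_def)
      then show ?thesis
        using YP_conn[OF y'(1)] by (rule converse_rtrancl_into_rtrancl)
    qed (rule YP_conn)
    then have "connected_on (torso R side) Y"
      by (intro connected_on_hub[OF sym_torso[OF R], of r]) (use r in \<open>auto simp: Y_def\<close>)
    moreover have "R `` C \<inter> (P \<union> T) \<subseteq> torso R side `` Y"
      using near_YP C_T by (fastforce simp: Y_def)
    moreover have "Y \<subseteq> P \<union> T - R `` C"
      using YP(1) C_T disj by (auto simp: Y_def)
    moreover have "Y \<noteq> {}" using r by (auto simp: Y_def)
    ultimately show ?thesis by blast
  qed
qed

lemma attached_side: "attached R (P \<union> T) side"
proof -
  let ?B = "P \<union> T \<union> Q"
  let ?F1 = "{C \<in> F. R `` C \<inter> ?B \<subseteq> P \<union> T}"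
  have fin: "finite F"
    and F: "\<And>C. C \<in> F \<Longrightarrow> connected_on R C" "\<And>C. C \<in> F \<Longrightarrow> C \<inter> ?B = {}"
    and anti: "\<And>C C'. C \<in> F \<Longrightarrow> C' \<in> F \<Longrightarrow> C \<noteq> C' \<Longrightarrow> C \<inter> C' = {} \<and> R `` C \<inter> C' = {}"
    using att unfolding attached_def by simp_all
  have absorb_disj: "absorb R F YQ \<inter> (P \<union> T) = {}"
  proof -
    have "\<Union> {C \<in> F. R `` C \<inter> YQ \<noteq> {}} \<inter> (P \<union> T) = {}"
      using F(2) by blast
    then show ?thesis
      using YQ(1) disj by (auto simp: absorb_def)
  qed
  have anti_absorb: "C \<inter> absorb R F YQ = {} \<and> R `` C \<inter> absorb R F YQ = {}" if C: "C \<in> ?F1" for C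
  proof -
    have C_Q: "R `` C \<inter> YQ = {}" "C \<inter> YQ = {}"
      using C YQ(1) disj F(2)[of C] by blast+
    have "C \<inter> C' = {} \<and> R `` C \<inter> C' = {}" if "C' \<in> F" "R `` C' \<inter> YQ \<noteq> {}" for C'
      using anti[of C C'] C that C_Q by blast
    with C_Q show ?thesis unfolding absorb_def by blast
  qed
  have anti_absorb': "R `` absorb R F YQ \<inter> C = {}" if "C \<in> ?F1" for C
    using anti_absorb[OF that] symD[OF R] by blast
  have anti_side: "\<forall>C \<in> side. \<forall>C' \<in> side. C \<noteq> C' \<longrightarrow> C \<inter> C' = {} \<and> R `` C \<inter> C' = {}"
  proof (intro ballI impI)
    fix C C' assume CC': "C \<in> side" "C' \<in> side" "C \<noteq> C'"
    then consider "C = absorb R F YQ" "C' \<in> ?F1" | "C' = absorb R F YQ" "C \<in> ?F1" | "C \<in> ?F1" "C' \<in> ?F1"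
      unfolding side_def by blast
    then show "C \<inter> C' = {} \<and> R `` C \<inter> C' = {}"
    proof cases
      case 1
      then show ?thesis using anti_absorb[of C'] anti_absorb'[of C'] by (simp add: Int_commute)
    next
      case 2
      then show ?thesis using anti_absorb[of C] by simp
    next
      case 3
      then show ?thesis using anti[of C C'] CC'(3) by simp
    qed
  qed
  have YP_side: "connected_on (torso R side) YP"
    using YP(3) by (rule connected_on_mono) (use torso_side YP(1) in auto)
  have T_YP: "T \<subseteq> torso R side `` YP"
  proof
    fix t assume t: "t \<in> T"
    then obtain y where y: "y \<in> YP" "(y, t) \<in> torso R F"
      using YP(4) by auto
    then show "t \<in> torso R side `` YP"
      using torso_side[OF y(2)] t YP(1) by auto
  qed
  have "\<exists>Y \<subseteq> P \<union> T - R `` C. Y \<noteq> {} \<and> connected_on (torso R side) Y \<and>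
      R `` C \<inter> (P \<union> T) \<subseteq> torso R side `` Y" if "C \<in> side" for C
  proof (cases "C = absorb R F YQ")
    case True
    have "YP \<subseteq> P \<union> T - R `` C"
      using True boundary YP(1) disj by blast
    then show ?thesis
      using YP(2) YP_side T_YP boundary True by (intro exI[of _ YP]) simp
  next
    case False
    then show ?thesis
      using that full_set_side[of C] unfolding side_def by simp
  qed
  moreover have "connected_on R C \<and> C \<inter> (P \<union> T) = {}" if "C \<in> side" for C
  proof (cases "C = absorb R F YQ")
    case True
    then show ?thesis using absorb_disj connected_absorb[OF R YQ(3) F(1)] by simp
  next
    case False
    then have "C \<in> F" using that by (simp add: side_def)
    then show ?thesis using F[of C] by auto
  qed
  moreover have "finite side" using fin by (simp add: side_def)
  ultimately show ?thesis
    using anti_side unfolding attached_def by blast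
qed

end

section \<open>Decomposition into bags with complete torso\<close>

lemma separated_swap:
  assumes "separated R P T Q YP YQ F"
  shows "separated R Q T P YQ YP F"
proof -
  interpret separated R P T Q YP YQ F by fact
  have "torso R F `` Q \<inter> P = {}"
    using no_edge[OF sym_tor] by auto
  then show ?thesis
    using R att disj YP YQ by unfold_locales (simp_all add: Un_ac Int_commute)
qed

text \<open>For nonadjacent \<open>x\<close> and \<open>y\<close>, the minimal separator close to \<open>y\<close> works: remove \<open>y\<close> and its
  neighbours, let \<open>P\<close> be the component of \<open>x\<close> and \<open>T\<close> its neighbourhood.  As \<open>T\<close> consists of
  neighbours of \<open>y\<close>, the set \<open>{y}\<close> is full on the other side.\<close>

lemma complete_separation:
  assumes R: "sym R" and att: "attached R B F" and incomplete: "\<not> complete_on (torso R F) B"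
  obtains P T Q YP YQ where "separated R P T Q YP YQ F" "B = P \<union> T \<union> Q"
proof -
  let ?R = "torso R F"
  note sym = symD[OF sym_torso[OF R]]
  obtain x y where xy: "x \<in> B" "y \<in> B" "x \<noteq> y" "(x, y) \<notin> ?R"
    using incomplete by (auto simp: complete_on_def)
  define U where "U = B - {y} - ?R `` {y}"
  define P where "P = {z. (x, z) \<in> (?R \<inter> U \<times> U)\<^sup>*}"
  define T where "T = ?R `` P \<inter> B - P"
  define Q where "Q = B - P - T"
  have "x \<in> U"
    using xy sym[of y x F] by (auto simp: U_def)
  have P_U: "P \<subseteq> U"
  proof
    fix z assume "z \<in> P"
    then have "(x, z) \<in> (?R \<inter> U \<times> U)\<^sup>*" by (simp add: P_def)
    then show "z \<in> U" by (induction rule: rtrancl_induct) (use \<open>x \<in> U\<close> in auto)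
  qed
  have x_P: "x \<in> P" by (simp add: P_def)
  have y_Q: "y \<in> Q"
  proof -
    have "y \<notin> ?R `` P"
      using P_U sym[of _ y F] by (auto simp: U_def)
    then show ?thesis
      using P_U xy(2) by (auto simp: Q_def T_def U_def)
  qed
  have T_y: "T \<subseteq> ?R `` {y}"
  proof
    fix t assume t: "t \<in> T"
    then obtain p where p: "p \<in> P" "(p, t) \<in> ?R" "t \<in> B" "t \<notin> P"
      by (auto simp: T_def)
    have "t \<notin> U"
    proof
      assume "t \<in> U"
      then have "(p, t) \<in> ?R \<inter> U \<times> U" using p(1,2) P_U by auto
      with p(1) have "t \<in> P" unfolding P_def by (auto intro: rtrancl_into_rtrancl)
      then show False using p(4) by simp
    qed
    moreover have "t \<noteq> y" using t y_Q by (auto simp: Q_def)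
    ultimately show "t \<in> ?R `` {y}" using p(3) by (auto simp: U_def)
  qed
  have P_conn: "(x, z) \<in> (?R \<inter> P \<times> P)\<^sup>*" if "z \<in> P" for z
  proof -
    have "(x, z) \<in> (?R \<inter> U \<times> U)\<^sup>*" using that by (simp add: P_def)
    then show ?thesis
    proof (induction rule: rtrancl_induct)
      case (step z z')
      then have "z \<in> P" "z' \<in> P"
        unfolding P_def by (auto intro: rtrancl_into_rtrancl)
      then have "(z, z') \<in> ?R \<inter> P \<times> P" using step.hyps(2) by auto
      with step.IH show ?case by (rule rtrancl_into_rtrancl)
    qed simp
  qed
  have "connected_on ?R P"
    using sym_rtrancl_restrict[OF sym_torso[OF R] P_conn] x_P
    by (intro connected_on_hub[OF sym_torso[OF R], of x]) auto
  moreover have B: "B = P \<union> T \<union> Q"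
    using P_U by (auto simp: Q_def T_def U_def)
  moreover have "?R `` P \<inter> Q = {}"
    by (auto simp: Q_def T_def)
  moreover have "P \<inter> T = {}" "P \<inter> Q = {}" "T \<inter> Q = {}"
    by (auto simp: Q_def T_def)
  moreover have "T \<subseteq> ?R `` P" by (auto simp: T_def)
  ultimately have "separated R P T Q P {y} F"
    using R att x_P y_Q T_y connected_on_singleton[of ?R y]
    by unfold_locales auto
  then show ?thesis using B by (rule that)
qed

text \<open>The set \<open>K\<close> makes the induction go through: a decomposition of one part that has the separator \<open>T\<close> in
  its root can be hung below the bag containing \<open>T\<close> in a decomposition of the other part, and the latter may
  still be rooted at any clique.  That cliques of the torso, and not only edges, lie in bags is needed to
  find the bag containing \<open>T\<close>.\<close>

lemma running_intersection_of_atoms: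
  assumes R: "sym R"
    and atom: "\<And>B F. finite B \<Longrightarrow> B \<subseteq> V \<Longrightarrow> attached R B F \<Longrightarrow> complete_on (torso R F) B \<Longrightarrow> card B \<le> N"
    and B: "finite B" "B \<subseteq> V" "attached R B F" "K \<subseteq> B" "complete_on (torso R F) K"
  shows "\<exists>xs. xs \<noteq> [] \<and> running_intersection xs \<and> \<Union> (set xs) = B \<and> K \<subseteq> hd xs \<and>
    (\<forall>b \<in> set xs. card b \<le> N) \<and>
    (\<forall>L \<subseteq> B. complete_on (torso R F) L \<longrightarrow> (\<exists>b \<in> set xs. L \<subseteq> b))"
  using B
proof (induction "card B" arbitrary: B F K rule: less_induct)
  case (less B F K)
  show ?case
  proof (cases "complete_on (torso R F) B")
    case True
    then have "card B \<le> N" using atom less.prems by blast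
    then show ?thesis
      using less.prems(4) by (intro exI[of _ "[B]"]) (simp add: running_intersection_def)
  next
    case False
    \<comment> \<open>The part containing \<open>K\<close> comes first, so that its root is the root of the whole.\<close>
    have glue: ?thesis
      if s: "separated R P T Q YP YQ F" and B_eq: "B = P \<union> T \<union> Q" and K: "K \<subseteq> P \<union> T"
      for P T Q YP YQ
    proof -
      interpret p: separated R P T Q YP YQ F by (rule s)
      interpret q: separated R Q T P YQ YP F by (rule separated_swap[OF s])
      have fin: "finite (P \<union> T)" "finite (Q \<union> T)" "P \<union> T \<subseteq> V" "Q \<union> T \<subseteq> V"
        using less.prems(1,2) B_eq by auto
      have "P \<union> T \<subset> B" "Q \<union> T \<subset> B"
        using p.YP(1,2) p.YQ(1,2) p.disj B_eq by blast+
      then have smaller: "card (P \<union> T) < card B" "card (Q \<union> T) < card B"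
        using less.prems(1) by (auto intro: psubset_card_mono)
      have complete_p: "complete_on (torso R p.side) L"
        if "complete_on (torso R F) L" "L \<subseteq> P \<union> T" for L
        using that p.torso_side unfolding complete_on_def by blast
      have complete_q: "complete_on (torso R q.side) L"
        if "complete_on (torso R F) L" "L \<subseteq> Q \<union> T" for L
        using that q.torso_side unfolding complete_on_def by blast
      obtain xs where xs: "xs \<noteq> []" "running_intersection xs" "\<Union> (set xs) = P \<union> T" "K \<subseteq> hd xs"
        "\<forall>b \<in> set xs. card b \<le> N"
        "\<forall>L \<subseteq> P \<union> T. complete_on (torso R p.side) L \<longrightarrow> (\<exists>b \<in> set xs. L \<subseteq> b)"
        using less.hyps[OF smaller(1) fin(1,3) p.attached_side K complete_p[OF less.prems(5) K]]
        by (elim exE conjE)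
      obtain ys where ys: "ys \<noteq> []" "running_intersection ys" "\<Union> (set ys) = Q \<union> T" "T \<subseteq> hd ys"
        "\<forall>b \<in> set ys. card b \<le> N"
        "\<forall>L \<subseteq> Q \<union> T. complete_on (torso R q.side) L \<longrightarrow> (\<exists>b \<in> set ys. L \<subseteq> b)"
        using less.hyps[OF smaller(2) fin(2,4) q.attached_side Un_upper2 q.complete_boundary]
        by (elim exE conjE)
      obtain b where b: "b \<in> set xs" "T \<subseteq> b"
        using xs(6) p.complete_boundary by auto
      have "\<Union> (set xs) \<inter> \<Union> (set ys) \<subseteq> T"
        unfolding xs(3) ys(3) using p.disj by auto
      then have "running_intersection (xs @ ys)"
        using running_intersection_append[OF xs(2) ys(2,1)] ys(4) b by simp
      moreover have "\<exists>b \<in> set (xs @ ys). L \<subseteq> b" if L: "L \<subseteq> B" "complete_on (torso R F) L" for L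
      proof -
        have "L \<inter> P = {} \<or> L \<inter> Q = {}"
        proof (rule ccontr)
          assume "\<not> ?thesis"
          then obtain u v where uv: "u \<in> L" "u \<in> P" "v \<in> L" "v \<in> Q" by auto
          then have "u \<noteq> v" using p.disj by auto
          then have "(u, v) \<in> torso R F"
            using L(2) uv by (auto simp: complete_on_def)
          then show False using p.no_edge uv by blast
        qed
        then consider "L \<subseteq> P \<union> T" | "L \<subseteq> Q \<union> T" using L(1) B_eq by blast
        then show ?thesis
        proof cases
          case 1
          obtain b where "b \<in> set xs" "L \<subseteq> b"
            using xs(6)[rule_format, OF 1 complete_p[OF L(2) 1]] ..
          then show ?thesis by auto
        next
          case 2
          obtain b where "b \<in> set ys" "L \<subseteq> b"
            using ys(6)[rule_format, OF 2 complete_q[OF L(2) 2]] ..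
          then show ?thesis by auto
        qed
      qed
      ultimately show ?thesis
        using xs(1,3,4,5) ys(3,5) B_eq
        by (intro exI[of _ "xs @ ys"]) auto
    qed
    obtain P T Q YP YQ where s: "separated R P T Q YP YQ F" and B_eq: "B = P \<union> T \<union> Q"
      using complete_separation[OF R less.prems(3) False] .
    have "K \<inter> P = {} \<or> K \<inter> Q = {}"
    proof (rule ccontr)
      assume "\<not> ?thesis"
      then obtain u v where uv: "u \<in> K" "u \<in> P" "v \<in> K" "v \<in> Q" by auto
      then have "u \<noteq> v" using separated.disj(2)[OF s] by auto
      then have "(u, v) \<in> torso R F"
        using less.prems(5) uv by (auto simp: complete_on_def)
      then show False using separated.no_edge[OF s] uv by blast
    qed
    then consider "K \<subseteq> P \<union> T" | "K \<subseteq> Q \<union> T" using less.prems(4) B_eq by blast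
    then show ?thesis
    proof cases
      case 1
      then show ?thesis by (rule glue[OF s B_eq])
    next
      case 2
      have "B = Q \<union> T \<union> P" using B_eq by auto
      then show ?thesis using 2 by (rule glue[OF separated_swap[OF s]])
    qed
  qed
qed

section \<open>Bags with complete torso in a 1-perfectly oriented graph\<close>

text \<open>A family of attached sets that is minimal with the property that the torso of \<open>B\<close> is complete contains a
  set \<open>C\<close> that alone covers some nonadjacent pair \<open>x\<close>, \<open>y\<close>.  Without \<open>C\<close>, the sets grown from \<open>x\<close> and
  from \<open>y\<close> are separated from each other, yet both are adjacent to every vertex of \<open>B\<close> outside the
  neighbourhood of \<open>C\<close>.  For the vertices in this neighbourhood, \<open>C\<close> itself and the set grown
  from a vertex \<open>w \<in> B\<close> outside it are the two connected sets.\<close>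

lemma atom_cover:
  assumes out: "\<And>v x y. (v, x) \<in> D \<Longrightarrow> (v, y) \<in> D \<Longrightarrow> x \<noteq> y \<Longrightarrow> (x, y) \<in> D \<union> D\<inverse>"
    and R: "R = D \<union> D\<inverse>"
    and att: "attached R B F" and complete: "complete_on (torso R F) B"
    and not_clique: "\<not> complete_on R B"
  obtains Z1 Z2 where "B = Z1 \<union> Z2" "triple_free R Z1" "triple_free R Z2"
proof -
  have sym: "sym R" unfolding R by (auto simp: sym_def)
  have fin: "finite F"
    and conn: "\<And>C. C \<in> F \<Longrightarrow> connected_on R C"
    and off: "\<And>C. C \<in> F \<Longrightarrow> C \<inter> B = {}"
    and anti: "\<And>C C'. C \<in> F \<Longrightarrow> C' \<in> F \<Longrightarrow> C \<noteq> C' \<Longrightarrow> C \<inter> C' = {} \<and> R `` C \<inter> C' = {}"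
    using att unfolding attached_def by simp_all
  have proper: "B - R `` C \<noteq> {}" if "C \<in> F" for C
  proof -
    have "\<forall>C \<in> F. \<exists>Y \<subseteq> B - R `` C. Y \<noteq> {} \<and> connected_on (torso R F) Y \<and>
        R `` C \<inter> B \<subseteq> torso R F `` Y"
      using att unfolding attached_def by (elim conjE)
    from bspec[OF this that] show ?thesis by auto
  qed
  define \<F> where "\<F> = {F'. F' \<subseteq> F \<and> complete_on (torso R F') B}"
  have "finite \<F>" "\<F> \<noteq> {}"
    using fin complete by (auto simp: \<F>_def)
  from finite_has_minimal[OF this] obtain F0 where F0: "F0 \<in> \<F>" "\<forall>F' \<in> \<F>. F' \<subseteq> F0 \<longrightarrow> F0 = F'"
    by blast
  have F0_F: "F0 \<subseteq> F" and F0_complete: "complete_on (torso R F0) B"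
    using F0(1) by (auto simp: \<F>_def)
  have "F0 \<noteq> {}"
    using F0_complete not_clique by (auto simp: complete_on_def torso_def)
  then obtain C where C: "C \<in> F0" by auto
  define F1 where "F1 = F0 - {C}"
  have "F1 \<notin> \<F>" using F0(2) C by (auto simp: F1_def)
  then have "\<not> complete_on (torso R F1) B"
    using F0_F by (auto simp: \<F>_def F1_def)
  then obtain x y where xy: "x \<in> B" "y \<in> B" "x \<noteq> y" "(x, y) \<notin> torso R F1"
    by (auto simp: complete_on_def)
  have C_F: "C \<in> F" using C F0_F by auto
  have F1_F: "C' \<in> F" "C' \<noteq> C" if "C' \<in> F1" for C'
    using that F0_F by (auto simp: F1_def)
  have only_C: "(u, v) \<in> torso R F1 \<or> u \<in> R `` C \<and> v \<in> R `` C" if uv: "u \<in> B" "v \<in> B" "u \<noteq> v" for u v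
  proof -
    have "(u, v) \<in> torso R F0"
      using F0_complete uv by (auto simp: complete_on_def)
    then show ?thesis
      unfolding torso_def F1_def by blast
  qed
  have xy_C: "x \<in> R `` C" "y \<in> R `` C"
    using only_C[OF xy(1-3)] xy(4) by auto
  have absorb_conn: "connected_on R (absorb R F1 {u})" for u
    using connected_absorb[OF sym connected_on_singleton] conn F1_F(1) by blast
  have absorb_B: "absorb R F1 {u} \<inter> B \<subseteq> {u}" for u
    using off F1_F(1) unfolding absorb_def by blast
  have adjacent_absorb: "v \<in> R `` absorb R F1 {u}" if uv: "u \<in> B" "v \<in> B" "u \<noteq> v" "\<not> (u \<in> R `` C \<and> v \<in> R `` C)"
    for u v
    using Image_absorb[of v "{u}" R F1] only_C[OF uv(1-3)] uv(3,4) by auto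
  have triple: "triple_free R Z"
    if "connected_on R P" "connected_on R Q" "P \<inter> Q = {}" "R `` P \<inter> Q = {}"
      "Z \<subseteq> R `` P" "Z \<subseteq> R `` Q" "Z \<inter> (P \<union> Q) = {}" for P Q Z
    unfolding R by (rule triple_free_between_connected_sets[OF out that[unfolded R]])
  have "triple_free R (B - R `` C)"
  proof (rule triple[OF absorb_conn[of x] absorb_conn[of y]])
    have in_absorb: "v = u \<or> (\<exists>C' \<in> F1. u \<in> R `` C' \<and> v \<in> C')" if "v \<in> absorb R F1 {u}" for u v
      using that unfolding absorb_def by auto
    have no_common: "\<not> (x \<in> R `` C' \<and> y \<in> R `` C')" if "C' \<in> F1" for C'
      using xy(3,4) that unfolding torso_def by blast
    show "absorb R F1 {x} \<inter> absorb R F1 {y} = {}"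
    proof (rule ccontr)
      assume "\<not> ?thesis"
      then obtain v where v: "v \<in> absorb R F1 {x}" "v \<in> absorb R F1 {y}" by auto
      have "v \<notin> B" using v absorb_B[of x] absorb_B[of y] xy(3) by auto
      then obtain C1 C2 where C12: "C1 \<in> F1" "x \<in> R `` C1" "v \<in> C1" "C2 \<in> F1" "y \<in> R `` C2" "v \<in> C2"
        using in_absorb[OF v(1)] in_absorb[OF v(2)] xy(1,2) by auto
      then have "C1 = C2" using anti[OF F1_F(1) F1_F(1), of C1 C2] by auto
      then show False using no_common C12 by blast
    qed
    show "R `` absorb R F1 {x} \<inter> absorb R F1 {y} = {}"
    proof (rule ccontr)
      assume "\<not> ?thesis"
      then obtain v where v: "v \<in> R `` absorb R F1 {x}" "v \<in> absorb R F1 {y}" by auto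
      from in_absorb[OF v(2)] show False
      proof
        assume "v = y"
        then show False
          using v(1) Image_absorb[of y "{x}" R F1] xy(3,4) by auto
      next
        assume "\<exists>C' \<in> F1. y \<in> R `` C' \<and> v \<in> C'"
        then obtain C2 where C2: "C2 \<in> F1" "y \<in> R `` C2" "v \<in> C2" by auto
        obtain w where w: "w \<in> absorb R F1 {x}" "(w, v) \<in> R" using v(1) by auto
        from in_absorb[OF w(1)] show False
        proof
          assume "w = x"
          then have "x \<in> R `` C2" using w(2) C2(3) symD[OF sym] by auto
          then show False using no_common C2 by auto
        next
          assume "\<exists>C' \<in> F1. x \<in> R `` C' \<and> w \<in> C'"
          then obtain C1 where C1: "C1 \<in> F1" "x \<in> R `` C1" "w \<in> C1" by auto
          then have "C1 = C2"
            using anti[OF F1_F(1)[OF C1(1)] F1_F(1)[OF C2(1)]] C2(3) w(2) by auto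
          then show False using no_common C1 C2 by auto
        qed
      qed
    qed
    show "B - R `` C \<subseteq> R `` absorb R F1 {x}" "B - R `` C \<subseteq> R `` absorb R F1 {y}"
      using adjacent_absorb[OF xy(1)] adjacent_absorb[OF xy(2)] xy_C by auto
    show "(B - R `` C) \<inter> (absorb R F1 {x} \<union> absorb R F1 {y}) = {}"
      using absorb_B[of x] absorb_B[of y] xy_C by blast
  qed
  moreover have "triple_free R (B \<inter> R `` C)"
  proof -
    obtain w where w: "w \<in> B" "w \<notin> R `` C" using proper[OF C_F] by auto
    show ?thesis
    proof (rule triple[OF conn[OF C_F] absorb_conn[of w]])
      have "C \<inter> C' = {}" "R `` C \<inter> C' = {}" if "C' \<in> F1" for C'
        using anti[OF C_F F1_F(1)[OF that]] F1_F(2)[OF that] by auto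
      moreover have "w \<notin> C" using w(1) off[OF C_F] by auto
      ultimately show "C \<inter> absorb R F1 {w} = {}" "R `` C \<inter> absorb R F1 {w} = {}"
        using w(2) unfolding absorb_def by blast+
      show "B \<inter> R `` C \<subseteq> R `` absorb R F1 {w}"
        using adjacent_absorb[OF w(1)] w(2) by auto
      show "B \<inter> R `` C \<inter> (C \<union> absorb R F1 {w}) = {}"
        using absorb_B[of w] off[OF C_F] w(2) by blast
    qed auto
  qed
  moreover have "B = (B - R `` C) \<union> (B \<inter> R `` C)" by auto
  ultimately show ?thesis using that by blast
qed

section \<open>The treewidth bound\<close>

lemma card_clique_le_clique_number:
  assumes "finite (verts G)" "K \<subseteq> verts G" "clique K (edges G)"
  shows "card K \<le> clique_number G"
  unfolding clique_number_def using assms by (intro Max_ge) auto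

lemma treewidth_one_perfectly_orientable:
  assumes G: "simple_graph G" and "one_perfectly_orientable G"
  shows "treewidth G \<le> max (clique_number G) (2 * ramsey_number (clique_number G + 1) 3 - 2) - 1"
proof -
  let ?k = "clique_number G"
  let ?r = "ramsey_number (?k + 1) 3"
  let ?N = "max ?k (2 * ?r - 2)"
  have fin: "finite (verts G)" and E: "edges G \<subseteq> [verts G]\<^bsup>2\<^esup>"
    using G by (auto simp: simple_graph_def)
  obtain D where D: "D \<union> D\<inverse> = {(u, v). {u, v} \<in> edges G}"
    and D_out: "\<forall>v \<in> verts G. clique (D `` {v}) (edges G)"
    using assms(2) unfolding one_perfectly_orientable_def orientation_def by auto
  define R where "R = D \<union> D\<inverse>"
  have R_edges: "(u, v) \<in> R \<longleftrightarrow> {u, v} \<in> edges G" for u v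
    using D by (auto simp: R_def)
  have sym: "sym R" by (auto simp: sym_def R_def)
  have out: "(x, y) \<in> D \<union> D\<inverse>" if vxy: "(v, x) \<in> D" "(v, y) \<in> D" "x \<noteq> y" for v x y
  proof -
    have "{v, x} \<in> edges G" using vxy(1) R_edges[of v x] by (simp add: R_def)
    then have "v \<in> verts G" using E by (auto simp: nsets_def)
    then have "{x, y} \<in> edges G" using D_out vxy by (auto simp: clique_def)
    then show ?thesis using R_edges[of x y] by (simp add: R_def)
  qed
  have small: "card Z < ?r" if Z: "Z \<subseteq> verts G" "triple_free R Z" for Z
  proof (rule card_less_ramsey_number[where E = "edges G"])
    show "finite Z" using Z(1) fin by (rule finite_subset)
    show "card S \<noteq> ?k + 1" if S: "S \<subseteq> Z" "clique S (edges G)" for S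
      using card_clique_le_clique_number[OF fin _ S(2)] S(1) Z(1) by fastforce
    show "card S \<noteq> 3" if S: "S \<subseteq> Z" "indep S (edges G)" for S
    proof
      assume "card S = 3"
      then obtain a b c where abc: "S = {a, b, c}" "a \<noteq> b" "b \<noteq> c" "a \<noteq> c"
        by (auto simp: card_3_iff)
      then have "(a, b) \<in> R \<or> (a, c) \<in> R \<or> (b, c) \<in> R"
        using Z(2) S(1) by (simp add: triple_free_def)
      then show False
        using S(2) abc by (auto simp: R_edges indep_def)
    qed
  qed
  have atom: "card B \<le> ?N"
    if B: "finite B" "B \<subseteq> verts G" "attached R B F" "complete_on (torso R F) B" for B F
  proof (cases "complete_on R B")
    case True
    then have "clique B (edges G)"
      by (simp add: complete_on_def clique_def R_edges)
    then have "card B \<le> ?k"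
      by (rule card_clique_le_clique_number[OF fin B(2)])
    then show ?thesis by simp
  next
    case False
    obtain Z1 Z2 where Z: "B = Z1 \<union> Z2" "triple_free R Z1" "triple_free R Z2"
      by (rule atom_cover[OF _ R_def B(3,4) False]) (rule out)
    have "card Z1 < ?r" "card Z2 < ?r"
      using small[OF _ Z(2)] small[OF _ Z(3)] Z(1) B(2) by simp_all
    moreover have "card B \<le> card Z1 + card Z2"
      unfolding Z(1) by (rule card_Un_le)
    ultimately show ?thesis by simp
  qed
  have "\<exists>xs. xs \<noteq> [] \<and> running_intersection xs \<and> \<Union> (set xs) = verts G \<and> {} \<subseteq> hd xs \<and>
      (\<forall>b \<in> set xs. card b \<le> ?N) \<and>
      (\<forall>L \<subseteq> verts G. complete_on (torso R {}) L \<longrightarrow> (\<exists>b \<in> set xs. L \<subseteq> b))"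
  proof (rule running_intersection_of_atoms[OF sym _ fin order.refl])
    show "attached R (verts G) {}" by (simp add: attached_def)
    show "complete_on (torso R {}) {}" by (simp add: complete_on_def)
  qed (use atom in simp_all)
  then obtain xs where xs: "xs \<noteq> []" "running_intersection xs" "\<Union> (set xs) = verts G"
    "\<forall>b \<in> set xs. card b \<le> ?N"
    "\<forall>L \<subseteq> verts G. complete_on (torso R {}) L \<longrightarrow> (\<exists>b \<in> set xs. L \<subseteq> b)"
    by (elim exE conjE)
  show ?thesis
  proof (rule treewidth_le_of_running_intersection[OF fin xs(1-3)])
    fix e assume e: "e \<in> edges G"
    then obtain u v where uv: "e = {u, v}" "u \<noteq> v" "e \<subseteq> verts G"
      using E by (auto simp: nsets_def card_2_iff)
    then have "complete_on (torso R {}) e"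
      using e R_edges by (auto simp: complete_on_def torso_def insert_commute)
    then show "\<exists>b \<in> set xs. e \<subseteq> b" using xs(5) uv(3) by blast
  qed (use xs(4) in blast)
qed

lemma induced_subgraph_one_perfectly_orientable:
  assumes "simple_graph G" "one_perfectly_orientable G" "induced_subgraph H G"
  shows "simple_graph H" "one_perfectly_orientable H"
proof -
  obtain S where S: "S \<subseteq> verts G" "S \<noteq> {}" "H = induce G S"
    using assms(3) by (auto simp: induced_subgraph_def)
  show "simple_graph H"
    using assms(1) S by (auto simp: simple_graph_def induce_def nsets_def intro: finite_subset)
  obtain D where D: "D \<union> D\<inverse> = {(u, v). {u, v} \<in> edges G}" "D \<inter> D\<inverse> = {}"
    "\<forall>v \<in> verts G. clique (D `` {v}) (edges G)"
    using assms(2) unfolding one_perfectly_orientable_def orientation_def by auto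
  let ?D = "D \<inter> S \<times> S"
  have "?D \<union> ?D\<inverse> = {(u, v). {u, v} \<in> edges H}"
    using D(1) by (auto simp: S(3) induce_def)
  moreover have "?D \<inter> ?D\<inverse> = {}" using D(2) by auto
  moreover have "clique (?D `` {v}) (edges H)" if "v \<in> verts H" for v
    using D(3) S that by (fastforce simp: clique_def induce_def)
  ultimately show "one_perfectly_orientable H"
    unfolding one_perfectly_orientable_def orientation_def by blast
qed

theorem corollary4p12:
  shows "tw_omega_bounded {G :: 'a ugraph. simple_graph G \<and> one_perfectly_orientable G} \<and>
    tw_omega_binding {G :: 'a ugraph. simple_graph G \<and> one_perfectly_orientable G}
      (\<lambda>k. max k (2 * ramsey_number (k + 1) 3 - 2) - 1)"
proof -
  have "tw_omega_binding {G :: 'a ugraph. simple_graph G \<and> one_perfectly_orientable G}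
      (\<lambda>k. max k (2 * ramsey_number (k + 1) 3 - 2) - 1)"
    unfolding tw_omega_binding_def
  proof (intro ballI allI impI)
    fix G H :: "'a ugraph"
    assume "G \<in> {G. simple_graph G \<and> one_perfectly_orientable G}" "induced_subgraph H G"
    then have "simple_graph H" "one_perfectly_orientable H"
      using induced_subgraph_one_perfectly_orientable[of G H] by simp_all
    then show "treewidth H \<le> max (clique_number H)
        (2 * ramsey_number (clique_number H + 1) 3 - 2) - 1"
      by (rule treewidth_one_perfectly_orientable)
  qed
  then show ?thesis
    unfolding tw_omega_bounded_def by blast
qed

end
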